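(* Consider the continuous-time three-pursuer one-evader game in $\mathbb{R}^2$ in which all players have unit speed and the initial evader position $E(0)$ lies strictly inside the convex hull of the initial pursuer positions $P_1(0),P_2(0),P_3(0)$. Let $M_{\mathcal{D}}=\|S-Q\|+\|Q-V_1(0)\|$ (with $S,Q,V_1(0)$ defined in the context), and let $M_{\mathcal{C}}$ be the optimal game length in a cooperative pursuers' setting. Then $$M_{\mathcal{C}}\le M_{\mathcal{D}}\le 2M_{\mathcal{C}}.$$
   Context: **Game.** $E(t)\in\mathbb{R}^2$ and $P_i(t)\in\mathbb{R}^2$, $i=1,2,3$, are the evader and pursuer positions, with $\dot E(t)=e(t)$, $\dot P_i(t)=w_i(t)$, $\|e(t)\|=\|w_i(t)\|=1$; players can move in any direction in the whole plane. Capture occurs at the first time $t$ with $P_i(t)=E(t)$ for some $i$; the game length is the capture time. The evader knows the full state of the game. **Voronoi cell.** $\mathcal{V}(t)$ is the set of points of the plane closer to $E(t)$ than to every $P_i(t)$. Under the assumptions, $\mathcal{V}(0)$ is a triangle. Its vertices are named $V_1,V_2,V_3$ so that $V_1$ is the vertex joining the longest and the medium edges and $\|V_1(0)-V_2(0)\|$ is the length of the longest edge. **Decentralized length $M_{\mathcal{D}}$.** Let $\mathcal{L}(V,v)=\{V+\alpha v:\alpha\in\mathbb{R}\}$ and $v=V_1(0)-V_2(0)$. Put $S=\overline{V_2(0)V_3(0)}\cap\mathcal{L}(E(0),v)$, $Q=\overline{V_1(0)V_3(0)}\cap\mathcal{L}(E(0),v)$ and $M_{\mathcal{D}}=\|S-Q\|+\|Q-V_1(0)\|$.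 This is the length of the game when the evader plays optimally against the following decentralized pursuers' strategy ($\mathcal{D}$-strategy): with $C_i(t)=(P_i(t)+E(t))/2$, $z_i(t)=P_i(t)-E(t)$, $z_i(t)^\perp\neq0$ orthogonal to $z_i(t)$, and $B_i(t)=\mathcal{L}(E(t),e(t))\cap\mathcal{L}(C_i(t),z_i(t)^\perp)$, pursuer $i$ plays $w_i(t)=e(t)$ if $z_i(t)'e(t)\le0$ and $w_i(t)=(B_i(t)-P_i(t))/\|B_i(t)-P_i(t)\|$ if $z_i(t)'e(t)>0$. **Cooperative length $M_{\mathcal{C}}$.** In a cooperative pursuers' strategy each pursuer knows the full game state and chooses $w_i(t)$ depending on $P_1(t),P_2(t),P_3(t),E(t)$ and $e(t)$. (The $\mathcal{D}$-strategy is a particular case.) A pursuers' strategy is optimal when it guarantees capture in minimum time. $M_{\mathcal{C}}$ is the maximum capture time under the optimal cooperative strategy, i.e. the capture time when the evader plays at its best: the infimum over cooperative pursuers' strategies of the supremum over evader behaviours of the capture time. **Limit convention.** When the evader is said to move to a point on the boundary of the Voronoi cell, it moves to an interior point of the cell at distance less than $\delta$ from it; all results are understood as limits for $\delta\to0$. *)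

theory Defs
  imports "HOL-Analysis.Analysis"
begin

type_synonym plane = "real^2"

text \<open>Positions of the three pursuers, indexed by the three-element type \<open>3\<close>.\<close>
type_synonym pursuers = "3 \<Rightarrow> plane"

text \<open>A cooperative strategy maps the pursuer positions, the evader position and the current
  evader velocity to the three pursuer velocities.\<close>
type_synonym strategy = "pursuers \<Rightarrow> plane \<Rightarrow> plane \<Rightarrow> pursuers"


section \<open>The game\<close>

definition evader_control :: "(real \<Rightarrow> plane) \<Rightarrow> bool" where
  "evader_control e \<longleftrightarrow>
     e \<in> borel_measurable (lebesgue_on {0..}) \<and> (\<forall>t\<ge>0. norm (e t) = 1)"

text \<open>The equations of motion are read in the Caratheodory sense, i.e. as integral equations.
  Motion formally continues after capture; this does not influence \<open>capture_time\<close>, and a strategy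
  may copy the velocity of the evader at captured states.\<close>
definition plays ::
  "strategy \<Rightarrow> pursuers \<Rightarrow> plane \<Rightarrow> ((real \<Rightarrow> plane) \<times> (real \<Rightarrow> pursuers) \<times> (real \<Rightarrow> plane)) set"
where
  "plays \<sigma> P0 E0 = {(e, P, E). evader_control e \<and>
     (\<forall>t\<ge>0. (e has_integral (E t - E0)) {0..t} \<and>
       (\<forall>i. ((\<lambda>s. \<sigma> (P s) (E s) (e s) i) has_integral (P t i - P0 i)) {0..t}))}"

text \<open>Since the velocities may be discontinuous in the state, solvability is part of the notion of
  a strategy: from every state, against every evader control, there must be a play. As states and
  controls are arbitrary, a play can then be continued from any of its states whatever the evader
  does next. Solutions need not be unique; \<open>guaranteed_time\<close> takes the worst case.\<close>
definition cooperative_strategy :: "strategy \<Rightarrow> bool" where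
  "cooperative_strategy \<sigma> \<longleftrightarrow>
     (\<forall>P E e i. norm e = 1 \<longrightarrow> norm (\<sigma> P E e i) = 1) \<and>
     (\<forall>P0 E0 e. evader_control e \<longrightarrow> (\<exists>P E. (e, P, E) \<in> plays \<sigma> P0 E0))"

text \<open>The value is \<open>\<infinity>\<close> if capture never occurs.\<close>
definition capture_time :: "(real \<Rightarrow> pursuers) \<Rightarrow> (real \<Rightarrow> plane) \<Rightarrow> ereal" where
  "capture_time P E = (INF t\<in>{t. 0 \<le> t \<and> (\<exists>i. P t i = E t)}. ereal t)"

definition guaranteed_time :: "strategy \<Rightarrow> pursuers \<Rightarrow> plane \<Rightarrow> ereal" where
  "guaranteed_time \<sigma> P0 E0 = (SUP (e, P, E)\<in>plays \<sigma> P0 E0. capture_time P E)"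

definition cooperative_length :: "pursuers \<Rightarrow> plane \<Rightarrow> ereal" where
  "cooperative_length P0 E0 = (INF \<sigma>\<in>{\<sigma>. cooperative_strategy \<sigma>}. guaranteed_time \<sigma> P0 E0)"


section \<open>The Voronoi cell and the decentralized length\<close>

definition voronoi_cell :: "pursuers \<Rightarrow> plane \<Rightarrow> plane set" where
  "voronoi_cell P E = {X. \<forall>i. dist X E < dist X (P i)}"

text \<open>The edge from \<open>V1\<close> to \<open>V2\<close> is longest and the edge from \<open>V1\<close> to \<open>V3\<close> is medium;
  in case of equal edge lengths several namings are possible.\<close>
definition voronoi_vertices :: "pursuers \<Rightarrow> plane \<Rightarrow> plane \<Rightarrow> plane \<Rightarrow> plane \<Rightarrow> bool" where
  "voronoi_vertices P E V1 V2 V3 \<longleftrightarrow>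
     {V1, V2, V3} = {X. X extreme_point_of closure (voronoi_cell P E)} \<and>
     norm (V2 - V3) \<le> norm (V1 - V3) \<and> norm (V1 - V3) \<le> norm (V1 - V2)"

definition line_dir :: "plane \<Rightarrow> plane \<Rightarrow> plane set" where
  "line_dir V v = {V + \<alpha> *\<^sub>R v | \<alpha>. True}"

text \<open>For \<open>E\<close> inside the triangle, both intersections below are singletons.\<close>
definition decentralized_length :: "plane \<Rightarrow> plane \<Rightarrow> plane \<Rightarrow> plane \<Rightarrow> real" where
  "decentralized_length E V1 V2 V3 =
     (let v = V1 - V2;
          S = the_elem (closed_segment V2 V3 \<inter> line_dir E v);
          Q = the_elem (closed_segment V1 V3 \<inter> line_dir E v)
      in norm (S - Q) + norm (Q - V1))"

end

theory Submission
  imports Defs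
begin

text \<open>Let \<open>l1, l2, l3\<close> be the barycentric coordinates of the evader in the triangle \<open>V1 V2 V3\<close>.
  Then \<open>D = (l1 + l2) \<bar>V1 - V2\<bar> + l3 \<bar>V1 - V3\<bar>\<close> is the decentralized length.

  Upper bound: let every pursuer reflect the evader velocity in its initial bisector whenever the
  evader approaches that bisector, and copy it otherwise. The evader is caught as soon as its
  accumulated approach to some bisector equals the initial distance to it. Maximising the survival
  time under these three constraints is a linear program over distributions of directions; the
  edge lengths \<open>\<bar>V1 - V2\<bar>, \<bar>V1 - V2\<bar>, \<bar>V1 - V3\<bar>\<close> are a dual feasible point of value \<open>D\<close>.

  Lower bound: an evader running straight to a vertex reaches it uncaught, and \<open>D\<close> is at most
  \<open>\<bar>V1 - V2\<bar>\<close>, which is at most the sum of the distances of the evader to \<open>V1\<close> and \<open>V2\<close>.\<close>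

section \<open>Barycentric coordinates\<close>

text \<open>Uniqueness of barycentric coordinates in difference form: subtracting two
  representations of one point leaves coefficients with sum 0.\<close>

lemma affine_coefficients_unique:
  fixes A B C :: "'a::euclidean_space"
  assumes "\<not> collinear {A, B, C}" and "a + b + c = 0"
    and "a *\<^sub>R A + b *\<^sub>R B + c *\<^sub>R C = 0"
  shows "a = 0" "b = 0" "c = 0"
proof -
  have dist: "A \<noteq> B" "A \<noteq> C" "B \<noteq> C" and indep: "\<not> affine_dependent {A, B, C}"
    using assms(1) by (auto simp: collinear_3_eq_affine_dependent)
  define u where "u = (\<lambda>X. if X = A then a else if X = B then b else c)"
  have "sum u {A, B, C} = 0" "(\<Sum>X\<in>{A, B, C}. u X *\<^sub>R X) = 0"
    using dist assms(2,3) by (auto simp: u_def add.assoc)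
  then have "\<forall>X\<in>{A, B, C}. u X = 0"
    using indep by (auto simp: affine_dependent_explicit_finite)
  then show "a = 0" "b = 0" "c = 0"
    using dist by (auto simp: u_def)
qed

text \<open>In the plane, at most two points or three affinely dependent ones have a convex hull
  with empty interior.\<close>

lemma interior_triangle_imp_not_collinear:
  fixes A B C :: plane
  assumes "X \<in> interior (convex hull {A, B, C})"
  shows "\<not> collinear {A, B, C}"
proof -
  have card: "card {A, B, C} = 3"
  proof (rule ccontr)
    assume "card {A, B, C} \<noteq> 3"
    then have "card {A, B, C} \<le> DIM(plane)"
      by (auto simp: card_insert_if split: if_splits)
    then show False
      using assms empty_interior_convex_hull[of "{A, B, C}"] by auto
  qed
  then have "\<not> affine_dependent {A, B, C}"
    using assms interior_convex_hull_eq_empty[of "{A, B, C}"] by auto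
  with card show ?thesis
    by (auto simp: collinear_3_eq_affine_dependent card_insert_if split: if_splits)
qed

lemma interior_triangle_barycentric:
  fixes A B C :: plane
  assumes "X \<in> interior (convex hull {A, B, C})"
  obtains a b c where "a > 0" "b > 0" "c > 0" "a + b + c = 1"
    "X = a *\<^sub>R A + b *\<^sub>R B + c *\<^sub>R C"
proof -
  have "\<not> collinear {A, B, C}"
    by (rule interior_triangle_imp_not_collinear[OF assms])
  then have dist: "A \<noteq> B" "A \<noteq> C" "B \<noteq> C" and indep: "\<not> affine_dependent {A, B, C}"
    by (auto simp: collinear_3_eq_affine_dependent)
  obtain u where "\<forall>Y\<in>{A, B, C}. 0 < u Y" "sum u {A, B, C} = 1"
      "(\<Sum>Y\<in>{A, B, C}. u Y *\<^sub>R Y) = X"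
    using assms dist by (auto simp: interior_convex_hull_explicit_minimal[OF indep])
  then show thesis
    using dist by (intro that[of "u A" "u B" "u C"]) (auto simp: add.assoc)
qed

text \<open>Applied to a velocity \<open>x\<close>, the coefficients are the rates of change of the
  barycentric coordinates. They come from those of the point \<open>x + A\<close> by taking away
  \<open>A\<close>.\<close>

lemma plane_direction_barycentric:
  fixes A B C x :: plane
  assumes "\<not> collinear {A, B, C}"
  obtains a b c where "a + b + c = 0" "x = a *\<^sub>R A + b *\<^sub>R B + c *\<^sub>R C"
proof -
  have dist: "A \<noteq> B" "A \<noteq> C" "B \<noteq> C" and indep: "\<not> affine_dependent {A, B, C}"
    using assms by (auto simp: collinear_3_eq_affine_dependent)
  have "affine hull {A, B, C} = UNIV"
    using dist by (intro affine_independent_span_eq[OF indep]) auto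
  then have "x + A \<in> affine hull {A, B, C}"
    by simp
  then obtain u v w where "u + v + w = 1" "x + A = u *\<^sub>R A + v *\<^sub>R B + w *\<^sub>R C"
    by (auto simp: affine_hull_3)
  then show thesis
    by (intro that[of "u - 1" v w]) (auto simp: algebra_simps)
qed


section \<open>The Voronoi cell\<close>

lemma dist_less_iff_inner:
  fixes X E P :: "'a::real_inner"
  shows "dist X E < dist X P \<longleftrightarrow> 2 * ((P - E) \<bullet> (X - E)) < (P - E) \<bullet> (P - E)"
  unfolding dist_norm norm_lt by (simp add: algebra_simps inner_commute)

lemma voronoi_cell_eq_halfspaces:
  "voronoi_cell P E = (\<Inter>i. {X. 2 * ((P i - E) \<bullet> (X - E)) < (P i - E) \<bullet> (P i - E)})"
  unfolding voronoi_cell_def dist_less_iff_inner by auto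

lemma open_voronoi_cell: "open (voronoi_cell P E)"
  unfolding voronoi_cell_eq_halfspaces
  by (intro open_INT finite ballI open_Collect_less continuous_intros)

lemma convex_voronoi_cell: "convex (voronoi_cell P E)"
proof -
  have "{X. 2 * (z \<bullet> (X - E)) < z \<bullet> z} = {X. z \<bullet> X < z \<bullet> z / 2 + z \<bullet> E}" for z
    by (auto simp: inner_diff_right)
  then show ?thesis
    unfolding voronoi_cell_eq_halfspaces by (auto intro!: convex_INT convex_halfspace_lt)
qed

text \<open>For \<open>X\<close> in the cell, the functional with normal \<open>X - E\<close> is
  bounded by one constant \<open>R\<close> at all pursuers (relative to \<open>E\<close>), hence on
  their hull. Evaluating it at the point of the ball around \<open>E\<close> in direction
  \<open>X - E\<close> gives \<open>r * dist E X \<le> R\<close>.\<close>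

lemma bounded_voronoi_cell:
  assumes "E \<in> interior (convex hull (range P))"
  shows "bounded (voronoi_cell P E)"
proof -
  obtain r where r: "r > 0" "cball E r \<subseteq> convex hull (range P)"
    using assms by (auto simp: mem_interior_cball)
  define R where "R = (\<Sum>i\<in>UNIV. (norm (P i - E))\<^sup>2)"
  have "dist E X \<le> R / r" if X: "X \<in> voronoi_cell P E" for X
  proof (cases "X = E")
    case True
    then show ?thesis
      using r by (auto simp: R_def intro!: divide_nonneg_pos sum_nonneg)
  next
    case False
    have "(P i - E) \<bullet> (X - E) \<le> R" for i
    proof -
      have "2 * ((P i - E) \<bullet> (X - E)) < (norm (P i - E))\<^sup>2"
        using X by (auto simp: voronoi_cell_eq_halfspaces power2_norm_eq_inner)
      moreover have "(norm (P i - E))\<^sup>2 \<le> R"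
        unfolding R_def by (rule member_le_sum) auto
      moreover have "0 \<le> R"
        unfolding R_def by (intro sum_nonneg) auto
      ultimately show ?thesis by linarith
    qed
    then have "range P \<subseteq> {Y. (X - E) \<bullet> Y \<le> R + (X - E) \<bullet> E}"
      by (auto simp: inner_diff_left inner_diff_right inner_commute algebra_simps)
    then have "convex hull (range P) \<subseteq> {Y. (X - E) \<bullet> Y \<le> R + (X - E) \<bullet> E}"
      by (intro hull_minimal convex_halfspace_le)
    moreover have "E + (r / norm (X - E)) *\<^sub>R (X - E) \<in> cball E r"
      using r False by (simp add: dist_norm)
    ultimately have "(r / norm (X - E)) * ((X - E) \<bullet> (X - E)) \<le> R"
      using r by (auto simp: inner_add_right dest!: subsetD)
    moreover have "(r / norm (X - E)) * ((X - E) \<bullet> (X - E)) = r * norm (X - E)"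
      using False by (simp add: power2_norm_eq_inner[symmetric] power2_eq_square)
    ultimately show ?thesis
      using r by (simp add: dist_norm norm_minus_commute field_simps)
  qed
  then show ?thesis
    unfolding bounded_def by blast
qed

text \<open>A vertex of a triangle is not interior to it, because interior points have only positive
  coordinates.\<close>

lemma pursuer_ne_evader:
  fixes P :: pursuers
  assumes "E \<in> interior (convex hull (range P))"
  shows "P i \<noteq> E"
proof
  assume eq: "P i = E"
  obtain j k where "UNIV = {i, j, k}"
    using exhaust_3[of i] UNIV_3 by (elim disjE) (auto simp: insert_commute)
  from arg_cong[OF this, of "image P"] have jk: "range P = {P i, P j, P k}"
    unfolding image_insert image_empty .
  obtain a b c where *: "a > 0" "b > 0" "c > 0" "a + b + c = 1"
      "E = a *\<^sub>R P i + b *\<^sub>R P j + c *\<^sub>R P k"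
    using assms interior_triangle_barycentric unfolding jk by metis
  have "\<not> collinear {P i, P j, P k}"
    using assms unfolding jk by (rule interior_triangle_imp_not_collinear)
  moreover have "(a - 1) *\<^sub>R P i + b *\<^sub>R P j + c *\<^sub>R P k = 0"
    using *(5) eq by (simp add: algebra_simps)
  ultimately have "b = 0"
    using *(4) affine_coefficients_unique(2)[of "P i" "P j" "P k" "a - 1" b c] by simp
  with * show False by simp
qed

lemma evader_in_voronoi_cell:
  assumes "E \<in> interior (convex hull (range P))"
  shows "E \<in> voronoi_cell P E"
  using pursuer_ne_evader[OF assms] by (simp add: voronoi_cell_def) metis

lemma closure_voronoi_cell_imp:
  assumes "X \<in> closure (voronoi_cell P E)"
  shows "2 * ((P i - E) \<bullet> (X - E)) \<le> (P i - E) \<bullet> (P i - E)"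
proof -
  have "closure (voronoi_cell P E) \<subseteq> {X. 2 * ((P i - E) \<bullet> (X - E)) \<le> (P i - E) \<bullet> (P i - E)}"
    by (intro closure_minimal closed_Collect_le continuous_intros)
      (auto simp: voronoi_cell_eq_halfspaces less_imp_le)
  with assms show ?thesis by auto
qed

lemma closure_voronoi_cell_eq_triangle:
  assumes "E \<in> interior (convex hull (range P))"
    and "voronoi_vertices P E V1 V2 V3"
  shows "closure (voronoi_cell P E) = convex hull {V1, V2, V3}"
proof -
  have "compact (closure (voronoi_cell P E))"
    using bounded_voronoi_cell[OF assms(1)] by (simp add: compact_closure)
  then show ?thesis
    using assms(2) Krein_Milman_Minkowski[of "closure (voronoi_cell P E)"]
      convex_closure[OF convex_voronoi_cell]
    by (simp add: voronoi_vertices_def)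
qed

text \<open>A point of the cell has only positive barycentric coordinates, so the midpoint of an
  edge violates one of the strict inequalities that define the cell.\<close>

lemma edge_on_bisector:
  assumes cl: "closure (voronoi_cell P E) = convex hull {A, B, C}"
    and nc: "\<not> collinear {A, B, C}"
  obtains i where "2 * ((P i - E) \<bullet> (A - E)) = (P i - E) \<bullet> (P i - E)"
    "2 * ((P i - E) \<bullet> (B - E)) = (P i - E) \<bullet> (P i - E)"
proof -
  define M where "M = (1/2) *\<^sub>R A + (1/2) *\<^sub>R B"
  have "M \<notin> voronoi_cell P E"
  proof
    assume "M \<in> voronoi_cell P E"
    then have "M \<in> interior (convex hull {A, B, C})"
      unfolding cl[symmetric]
      using interior_maximal[OF closure_subset open_voronoi_cell] by blast
    then obtain a b c where *: "a > 0" "b > 0" "c > 0" "a + b + c = 1"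
        "M = a *\<^sub>R A + b *\<^sub>R B + c *\<^sub>R C"
      by (rule interior_triangle_barycentric)
    have "c = 0"
    proof (rule affine_coefficients_unique(3)[OF nc])
      show "(a - 1/2) + (b - 1/2) + c = 0"
        using * by simp
      show "(a - 1/2) *\<^sub>R A + (b - 1/2) *\<^sub>R B + c *\<^sub>R C = 0"
        using *(5) by (simp add: M_def algebra_simps)
    qed
    with * show False by simp
  qed
  then obtain i where i: "2 * ((P i - E) \<bullet> (M - E)) \<ge> (P i - E) \<bullet> (P i - E)"
    by (auto simp: voronoi_cell_eq_halfspaces not_less)
  have "M - E = (1/2) *\<^sub>R (A - E) + (1/2) *\<^sub>R (B - E)"
    by (simp add: M_def algebra_simps flip: scaleR_left.add)
  then have "(P i - E) \<bullet> (M - E) = ((P i - E) \<bullet> (A - E) + (P i - E) \<bullet> (B - E)) / 2"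
    by (simp only: inner_add_right inner_scaleR_right) simp
  moreover have "A \<in> closure (voronoi_cell P E)" "B \<in> closure (voronoi_cell P E)"
    unfolding cl by (auto intro: hull_inc)
  note this[THEN closure_voronoi_cell_imp[of _ P E i]]
  \<comment> \<open>The value at the midpoint is the mean of the values at \<open>A\<close> and
    \<open>B\<close>. Neither of these exceeds the bound while the mean attains it, so both attain
    it.\<close>
  moreover have "2 * x = q \<and> 2 * y = q"
    if "m = (x + y) / 2" "2 * x \<le> q" "2 * y \<le> q" "q \<le> 2 * m" for m x y q :: real
    using that by auto
  ultimately show thesis
    using i that by blast
qed


section \<open>The decentralized length\<close>

text \<open>Moving along \<open>V1 - V2\<close> leaves the third coordinate fixed. So
  \<open>S\<close> is reached when the first coordinate has become 0, at
  \<open>E - a *\<^sub>R v\<close>, and \<open>Q\<close> when the second has, at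
  \<open>E + b *\<^sub>R v\<close>.\<close>

lemma decentralized_length_barycentric:
  assumes nc: "\<not> collinear {V1, V2, V3}"
    and pos: "a \<ge> 0" "b \<ge> 0" "c \<ge> 0" and sum: "a + b + c = 1"
    and E: "E = a *\<^sub>R V1 + b *\<^sub>R V2 + c *\<^sub>R V3"
  shows "decentralized_length E V1 V2 V3 = (a + b) * norm (V1 - V2) + c * norm (V1 - V3)"
proof -
  define v where "v = V1 - V2"
  have sub: "1 - c = a + b" "1 - a = b + c" "1 - b = a + c" "c \<le> 1"
    using sum pos by auto
  have S: "closed_segment V2 V3 \<inter> line_dir E v = {E - a *\<^sub>R v}"
  proof (intro equalityI subsetI)
    fix X assume "X \<in> closed_segment V2 V3 \<inter> line_dir E v"
    then obtain u \<alpha> where u: "X = (1 - u) *\<^sub>R V2 + u *\<^sub>R V3" "X = E + \<alpha> *\<^sub>R v"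
      by (auto simp: in_segment line_dir_def)
    have "a + \<alpha> = 0"
    proof (rule affine_coefficients_unique(1)[OF nc])
      show "(a + \<alpha>) + (b - \<alpha> - (1 - u)) + (c - u) = 0"
        using sum by simp
      show "(a + \<alpha>) *\<^sub>R V1 + (b - \<alpha> - (1 - u)) *\<^sub>R V2 + (c - u) *\<^sub>R V3 = 0"
        using u by (simp add: E v_def algebra_simps)
    qed
    then have "\<alpha> = - a" by simp
    with u(2) show "X \<in> {E - a *\<^sub>R v}" by simp
  next
    fix X assume "X \<in> {E - a *\<^sub>R v}"
    then have X: "X = E + (- a) *\<^sub>R v" by simp
    moreover have "X = (1 - c) *\<^sub>R V2 + c *\<^sub>R V3"
      unfolding X E v_def sub by (simp add: algebra_simps)
    ultimately show "X \<in> closed_segment V2 V3 \<inter> line_dir E v"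
      unfolding in_segment line_dir_def Int_iff mem_Collect_eq using pos sub(4) by blast
  qed
  have Q: "closed_segment V1 V3 \<inter> line_dir E v = {E + b *\<^sub>R v}"
  proof (intro equalityI subsetI)
    fix X assume "X \<in> closed_segment V1 V3 \<inter> line_dir E v"
    then obtain u \<alpha> where u: "X = (1 - u) *\<^sub>R V1 + u *\<^sub>R V3" "X = E + \<alpha> *\<^sub>R v"
      by (auto simp: in_segment line_dir_def)
    have "b - \<alpha> = 0"
    proof (rule affine_coefficients_unique(2)[OF nc])
      show "(a + \<alpha> - (1 - u)) + (b - \<alpha>) + (c - u) = 0"
        using sum by simp
      show "(a + \<alpha> - (1 - u)) *\<^sub>R V1 + (b - \<alpha>) *\<^sub>R V2 + (c - u) *\<^sub>R V3 = 0"
        using u by (simp add: E v_def algebra_simps)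
    qed
    with u(2) show "X \<in> {E + b *\<^sub>R v}" by simp
  next
    fix X assume "X \<in> {E + b *\<^sub>R v}"
    then have X: "X = E + b *\<^sub>R v" by simp
    moreover have "X = (1 - c) *\<^sub>R V1 + c *\<^sub>R V3"
      unfolding X E v_def sub by (simp add: algebra_simps)
    ultimately show "X \<in> closed_segment V1 V3 \<inter> line_dir E v"
      unfolding in_segment line_dir_def Int_iff mem_Collect_eq using pos sub(4) by blast
  qed
  have "(E - a *\<^sub>R v) - (E + b *\<^sub>R v) = (- (a + b)) *\<^sub>R v"
    by (simp add: algebra_simps)
  then have 1: "norm ((E - a *\<^sub>R v) - (E + b *\<^sub>R v)) = (a + b) * norm v"
    using pos by (simp only: norm_scaleR) simp
  have "a = 1 - b - c"
    using sum by simp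
  then have "(E + b *\<^sub>R v) - V1 = (- c) *\<^sub>R (V1 - V3)"
    unfolding E v_def \<open>a = 1 - b - c\<close> by (simp add: algebra_simps)
  then have 2: "norm ((E + b *\<^sub>R v) - V1) = c * norm (V1 - V3)"
    using pos by (simp only: norm_scaleR) simp
  show ?thesis
    unfolding decentralized_length_def Let_def v_def[symmetric] S Q the_elem_eq 1 2 ..
qed


section \<open>Lower bound: running straight\<close>

lemma evader_control_const:
  assumes "norm v = 1"
  shows "evader_control (\<lambda>_. v)"
  using assms by (simp add: evader_control_def)

text \<open>A pursuer capturing the evader early on its straight run to \<open>X\<close> could go on
  along the run and be at \<open>X\<close> by time \<open>dist X E0\<close>. Its initial distance to
  \<open>X\<close> would then be at most that of the evader, contrary to the definition of the
  cell.\<close>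

lemma cooperative_length_ge_dist:
  assumes X: "X \<in> voronoi_cell P0 E0"
  shows "ereal (dist X E0) \<le> cooperative_length P0 E0"
  unfolding cooperative_length_def
proof (rule INF_greatest, clarify)
  fix \<sigma> assume \<sigma>: "cooperative_strategy \<sigma>"
  define d where "d = dist X E0"
  obtain v where v: "norm v = 1" "X = E0 + d *\<^sub>R v"
  proof (cases "X = E0")
    case True
    \<comment> \<open>Here \<open>d = 0\<close>, so any unit vector will do.\<close>
    then show thesis
      using that[of "axis 1 1"] by (simp add: d_def)
  next
    case False
    then show thesis
      using that[of "(1 / d) *\<^sub>R (X - E0)"] by (simp add: d_def dist_norm)
  qed
  obtain P E where pl: "((\<lambda>_. v), P, E) \<in> plays \<sigma> P0 E0"
    using \<sigma> evader_control_const[OF v(1)] unfolding cooperative_strategy_def by metis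
  have "ereal d \<le> capture_time P E"
    unfolding capture_time_def
  proof (rule INF_greatest, clarify)
    fix t i assume t: "0 \<le> t" "P t i = E t"
    have "((\<lambda>_. v) has_integral (E t - E0)) {0..t}"
      using pl t(1) by (auto simp: plays_def)
    moreover have "((\<lambda>_. v) has_integral (t *\<^sub>R v)) {0..t}"
      using has_integral_const_real[of v 0 t] t(1) by simp
    ultimately have "E t - E0 = t *\<^sub>R v"
      by (rule has_integral_unique)
    then have Et: "E t = E0 + t *\<^sub>R v" by (simp add: algebra_simps)
    have "((\<lambda>s. \<sigma> (P s) (E s) v i) has_integral (P t i - P0 i)) {0..t}"
      using pl t(1) by (auto simp: plays_def)
    moreover have "norm (\<sigma> (P s) (E s) v i) \<le> 1" for s
      using \<sigma> v(1) by (simp add: cooperative_strategy_def)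
    ultimately have "norm (P t i - P0 i) \<le> 1 * measure lborel {0..t}"
      by (intro has_integral_bound_real[where B = 1 and S = "{}"]) auto
    then have "norm (P t i - P0 i) \<le> t"
      using t(1) by simp
    show "ereal d \<le> ereal t"
    proof (rule ccontr)
      assume "\<not> ereal d \<le> ereal t"
      then have less: "t < d" by simp
      have "dist X (P0 i) \<le> dist X (E t) + dist (P t i) (P0 i)"
        unfolding t(2) by (rule dist_triangle)
      also have "X - E t = (d - t) *\<^sub>R v"
        by (simp add: v(2) Et algebra_simps)
      then have "dist X (E t) = d - t"
        using less v(1) by (simp add: dist_norm)
      also have "dist (P t i) (P0 i) \<le> t"
        using \<open>norm (P t i - P0 i) \<le> t\<close> by (simp add: dist_norm)
      finally have "dist X (P0 i) \<le> dist X E0"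
        by (simp add: d_def)
      with X show False
        by (auto simp: voronoi_cell_def not_le[symmetric])
    qed
  qed
  also have "\<dots> \<le> guaranteed_time \<sigma> P0 E0"
    unfolding guaranteed_time_def by (rule SUP_upper2[OF pl]) simp
  finally show "ereal (dist X E0) \<le> guaranteed_time \<sigma> P0 E0"
    by (simp add: d_def)
qed

text \<open>This realises the limit convention: vertices of the cell are only limits of its points,
  and the bound is a closed condition on \<open>X\<close>.\<close>

lemma cooperative_length_ge_dist_closure:
  assumes "X \<in> closure (voronoi_cell P0 E0)"
  shows "ereal (dist X E0) \<le> cooperative_length P0 E0"
proof -
  have "closed {X. ereal (dist X E0) \<le> cooperative_length P0 E0}"
    by (intro closed_Collect_le continuous_intros)
  then have "closure (voronoi_cell P0 E0) \<subseteq> {X. ereal (dist X E0) \<le> cooperative_length P0 E0}"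
    using cooperative_length_ge_dist by (intro closure_minimal) auto
  with assms show ?thesis by auto
qed


section \<open>Upper bound: reflecting in the initial bisectors\<close>

text \<open>Dual feasibility of the weights \<open>\<bar>A - B\<bar>, \<bar>A - B\<bar>, \<bar>A - C\<bar>\<close>.\<close>

lemma norm_barycentric_le:
  fixes A B C :: "'a::real_normed_vector"
  assumes sum: "a + b + c = (0::real)"
    and le: "norm (B - C) \<le> norm (A - C)" "norm (A - C) \<le> norm (A - B)"
  shows "norm (a *\<^sub>R A + b *\<^sub>R B + c *\<^sub>R C) \<le>
    max 0 (- a) * norm (A - B) + max 0 (- b) * norm (A - B) + max 0 (- c) * norm (A - C)"
proof -
  let ?x = "a *\<^sub>R A + b *\<^sub>R B + c *\<^sub>R C"
  have c: "c = - a - b"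
    using sum by simp
  \<comment> \<open>Each form eliminates one coefficient. For every sign pattern of
    \<open>a\<close>, \<open>b\<close>, \<open>c\<close> below, one of the three resulting
    estimates, together with the order of the edge lengths, suffices.\<close>
  have "?x = a *\<^sub>R (A - C) + b *\<^sub>R (B - C)" "?x = b *\<^sub>R (B - A) + c *\<^sub>R (C - A)"
      "?x = a *\<^sub>R (A - B) + c *\<^sub>R (C - B)"
    unfolding c by (simp_all add: algebra_simps)
  then have n: "norm ?x \<le> \<bar>a\<bar> * norm (A - C) + \<bar>b\<bar> * norm (B - C)"
      "norm ?x \<le> \<bar>b\<bar> * norm (A - B) + \<bar>c\<bar> * norm (A - C)"
      "norm ?x \<le> \<bar>a\<bar> * norm (A - B) + \<bar>c\<bar> * norm (B - C)"
    by (metis norm_triangle_ineq norm_scaleR norm_minus_commute)+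
  have m: "\<bar>k\<bar> * norm (B - C) \<le> \<bar>k\<bar> * norm (A - C)" "\<bar>k\<bar> * norm (A - C) \<le> \<bar>k\<bar> * norm (A - B)" for k
    using le by (auto intro: mult_left_mono)
  have s: "a * N + b * N + c * N = 0" for N
    using sum by (simp flip: distrib_right)
  note facts = n m[of a] m[of b] m[of c] s[of "norm (A - B)"] s[of "norm (A - C)"]
  consider "0 \<le> a" "0 \<le> b" "c \<le> 0" | "0 \<le> a" "b \<le> 0" "0 \<le> c" | "0 \<le> a" "b \<le> 0" "c \<le> 0"
    | "a \<le> 0" "0 \<le> b" "0 \<le> c" | "a \<le> 0" "0 \<le> b" "c \<le> 0" | "a \<le> 0" "b \<le> 0" "0 \<le> c"
    using sum by linarith
  then show ?thesis
    by cases (insert facts; simp only: abs_of_nonneg abs_of_nonpos max_absorb1 max_absorb2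
      neg_le_0_iff_le neg_0_le_iff_le mult_minus_left; linarith)+
qed

text \<open>For \<open>z = P i - E\<close> the bisector is at distance \<open>norm z / 2\<close>
  from the evader, so this is the speed of approach to the bisector as a fraction of that distance,
  cut off at 0 when the evader does not approach.\<close>

definition reflect_rate :: "plane \<Rightarrow> plane \<Rightarrow> real" where
  "reflect_rate z e = max 0 (2 * (z \<bullet> e) / (z \<bullet> z))"

text \<open>The decentralized strategy keeps the direction of each \<open>P i - E\<close> constant, so up to the
  capture it is the following open-loop reflection in the initial directions.\<close>

definition initial_reflection :: "pursuers \<Rightarrow> plane \<Rightarrow> strategy" where
  "initial_reflection P0 E0 P E e i = e - reflect_rate (P0 i - E0) e *\<^sub>R (P0 i - E0)"

text \<open>For a positive rate the vector is the mirror image of \<open>e\<close> in the line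
  orthogonal to \<open>z\<close>; otherwise it is \<open>e\<close> itself.\<close>

lemma norm_reflect:
  assumes "norm e = 1"
  shows "norm (e - reflect_rate z e *\<^sub>R z) = 1"
proof (cases "z \<bullet> e > 0")
  case True
  then have z: "z \<bullet> z > 0"
    by (metis inner_eq_zero_iff inner_gt_zero_iff inner_zero_left less_irrefl)
  then have r: "reflect_rate z e = 2 * (z \<bullet> e) / (z \<bullet> z)"
    using True by (simp add: reflect_rate_def)
  have "(e - reflect_rate z e *\<^sub>R z) \<bullet> (e - reflect_rate z e *\<^sub>R z) = e \<bullet> e"
    unfolding r using z
    by (simp add: inner_diff_left inner_diff_right inner_commute[of e z] field_simps)
  then show ?thesis
    using assms by (simp add: norm_eq_sqrt_inner)
next
  case False
  then have "2 * (z \<bullet> e) / (z \<bullet> z) \<le> 0"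
    by (intro divide_nonpos_nonneg) auto
  then have "reflect_rate z e = 0"
    by (simp add: reflect_rate_def)
  then show ?thesis
    using assms by simp
qed

lemma continuous_reflect_rate: "continuous_on UNIV (reflect_rate z)"
  unfolding reflect_rate_def divide_inverse by (intro continuous_intros)

text \<open>Controls are merely measurable, but their values lie on the unit circle, where a
  continuous \<open>g\<close> is bounded.\<close>

lemma integrable_evader_control:
  fixes g :: "plane \<Rightarrow> 'a::euclidean_space"
  assumes e: "evader_control e" and g: "continuous_on UNIV g"
  shows "(\<lambda>s. g (e s)) integrable_on {0..t}"
proof -
  have "compact (g ` sphere 0 1)"
    using g by (intro compact_continuous_image) (auto intro: continuous_on_subset)
  then obtain B where B: "\<And>x. norm x = 1 \<Longrightarrow> norm (g x) \<le> B"
    by (force dest!: compact_imp_bounded simp: bounded_iff)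
  have "e \<in> borel_measurable (lebesgue_on {0..t})"
    using e by (auto simp: evader_control_def elim: measurable_restrict_mono)
  then have "(\<lambda>s. g (e s)) \<in> borel_measurable (lebesgue_on {0..t})"
    using borel_measurable_continuous_onI[OF g] by (rule measurable_compose)
  then show ?thesis
    by (rule measurable_bounded_by_integrable_imp_integrable[where g = "\<lambda>_. B"])
      (use e B in \<open>auto simp: evader_control_def\<close>)
qed

lemma cooperative_strategy_initial_reflection:
  "cooperative_strategy (initial_reflection P0 E0)"
  unfolding cooperative_strategy_def
proof (intro conjI allI impI)
  show "norm (initial_reflection P0 E0 P E e i) = 1" if "norm e = 1" for P E e i
    using that by (simp add: initial_reflection_def norm_reflect)
next
  fix Q0 :: pursuers and F0 :: plane and e assume e: "evader_control e"
  have "(\<lambda>s. initial_reflection P0 E0 P E (e s) i) integrable_on {0..t}" for P E i t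
    unfolding initial_reflection_def
    by (intro integrable_evader_control[OF e] continuous_intros continuous_reflect_rate)
  then have 1: "((\<lambda>s. initial_reflection P0 E0 P E (e s) i) has_integral
      integral {0..t} (\<lambda>s. initial_reflection P0 E0 P E (e s) i)) {0..t}" for P E i t
    by (rule integrable_integral)
  have 2: "(e has_integral integral {0..t} e) {0..t}" for t
    using integrable_evader_control[OF e continuous_on_id] by (simp add: integrable_integral)
  \<comment> \<open>The strategy ignores the current state, so a play from any state is obtained by
    integrating the control, with no differential equation to solve. The state arguments
    \<open>P0 E0\<close> inside the integral are placeholders.\<close>
  have "(e, \<lambda>t i. Q0 i + integral {0..t} (\<lambda>s. initial_reflection P0 E0 P0 E0 (e s) i),
      \<lambda>t. F0 + integral {0..t} e) \<in> plays (initial_reflection P0 E0) Q0 F0"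
    using e 1[of P0 E0] 2 by (simp add: plays_def initial_reflection_def)
  then show "\<exists>P E. (e, P, E) \<in> plays (initial_reflection P0 E0) Q0 F0"
    by blast
qed

text \<open>The relative velocity of pursuer \<open>i\<close> is always a multiple of its initial
  offset \<open>P0 i - E0\<close>, so the offset only shrinks along a fixed line.\<close>

lemma plays_initial_reflection:
  assumes "(e, P, E) \<in> plays (initial_reflection P0 E0) P0 E0" and "t \<ge> 0"
  shows "P t i - E t = (1 - integral {0..t} (\<lambda>s. reflect_rate (P0 i - E0) (e s))) *\<^sub>R (P0 i - E0)"
proof -
  let ?r = "\<lambda>s. reflect_rate (P0 i - E0) (e s)"
  have e: "evader_control e" "(e has_integral (E t - E0)) {0..t}"
    and P: "((\<lambda>s. e s - ?r s *\<^sub>R (P0 i - E0)) has_integral (P t i - P0 i)) {0..t}"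
    using assms by (auto simp: plays_def initial_reflection_def)
  have "(?r has_integral integral {0..t} ?r) {0..t}"
    by (intro integrable_integral integrable_evader_control[OF e(1) continuous_reflect_rate])
  then have "((\<lambda>s. ?r s *\<^sub>R (P0 i - E0)) has_integral integral {0..t} ?r *\<^sub>R (P0 i - E0)) {0..t}"
    by (rule has_integral_scaleR_left)
  from has_integral_diff[OF e(2) this]
  have "E t - E0 - integral {0..t} ?r *\<^sub>R (P0 i - E0) = P t i - P0 i"
    using P by (rule has_integral_unique)
  then show ?thesis
    by (simp add: algebra_simps)
qed

text \<open>The accumulated rate may exceed 1 at time \<open>T\<close>, since motion formally
  continues after capture. It is continuous and starts at 0, so it equals 1 at some earlier or equal
  time, when the offset vanishes.\<close>

lemma capture_time_le:
  assumes pl: "(e, P, E) \<in> plays (initial_reflection P0 E0) P0 E0" and "T \<ge> 0"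
    and "integral {0..T} (\<lambda>s. reflect_rate (P0 i - E0) (e s)) \<ge> 1"
  shows "capture_time P E \<le> ereal T"
proof -
  define R where "R t = integral {0..t} (\<lambda>s. reflect_rate (P0 i - E0) (e s))" for t
  have "evader_control e"
    using pl by (simp add: plays_def)
  then have "continuous_on {0..T} R"
    unfolding R_def
    by (intro indefinite_integral_continuous_1 integrable_evader_control continuous_reflect_rate)
  moreover have "R 0 = 0"
    by (simp add: R_def)
  ultimately obtain t where t: "0 \<le> t" "t \<le> T" "R t = 1"
    using IVT'[of R 0 1 T] assms(2,3) by (auto simp: R_def)
  then have "P t i = E t"
    using plays_initial_reflection[OF pl t(1), of i] by (simp add: R_def)
  then have "capture_time P E \<le> ereal t"
    unfolding capture_time_def using t by (intro INF_lower) auto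
  with t show ?thesis
    by (meson ereal_less_eq(3) order_trans)
qed

text \<open>On the edge opposite to a vertex with barycentric coordinate \<open>l\<close>, the linear functional
  \<open>2 * (z \<bullet> x) / (z \<bullet> z)\<close> is 1, so a direction \<open>x\<close> changes \<open>l\<close> at rate \<open>- l\<close> times its value.\<close>

lemma bisector_barycentric_rate:
  fixes z A B C E x :: plane
  assumes z: "z \<noteq> 0" and l: "l > 0" "k + m + l = 1" "E = k *\<^sub>R A + m *\<^sub>R B + l *\<^sub>R C"
    and x: "a + b + c = 0" "x = a *\<^sub>R A + b *\<^sub>R B + c *\<^sub>R C"
    and AB: "2 * (z \<bullet> (A - E)) = z \<bullet> z" "2 * (z \<bullet> (B - E)) = z \<bullet> z"
  shows "max 0 (- c) = l * reflect_rate z x"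
proof -
  define f where "f y = 2 * (z \<bullet> y) / (z \<bullet> z)" for y
  have lin: "f (u *\<^sub>R y) = u * f y" "f (y + w) = f y + f w" for u y w
    by (simp_all add: f_def inner_add_right add_divide_distrib)
  have f: "f (A - E) = 1" "f (B - E) = 1"
    using AB z by (simp_all add: f_def)
  \<comment> \<open>The weighted offsets of the vertices from \<open>E\<close> cancel; applying
    \<open>f\<close>, which is 1 at \<open>A - E\<close> and \<open>B - E\<close>, determines its
    value at \<open>C - E\<close>.\<close>
  have "k *\<^sub>R (A - E) + m *\<^sub>R (B - E) + l *\<^sub>R (C - E) = E - (k + m + l) *\<^sub>R E"
    unfolding l(3) by (simp add: algebra_simps)
  then have "k * f (A - E) + m * f (B - E) + l * f (C - E) = f 0"
    using l(2) by (metis lin diff_self scaleR_one)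
  then have g: "l * f (C - E) = l - 1"
    using f l(2) by (simp add: f_def)
  have "x = a *\<^sub>R (A - E) + b *\<^sub>R (B - E) + c *\<^sub>R (C - E) + (a + b + c) *\<^sub>R E"
    unfolding x(2) by (simp add: algebra_simps)
  then have "f x = a * f (A - E) + b * f (B - E) + c * f (C - E)"
    using x(1) by (simp add: lin)
  then have "l * f x = l * (a + b) + c * (l * f (C - E))"
    using f by (simp add: algebra_simps)
  also have "\<dots> = l * (a + b + c) - c"
    unfolding g by (simp add: algebra_simps)
  finally have "l * f x = - c"
    using x(1) by simp
  moreover have "l * reflect_rate z x = max 0 (l * f x)"
    using l(1) by (simp add: reflect_rate_def f_def max_mult_distrib_left)
  ultimately show ?thesis by simp
qed

theorem theorem3:
  fixes P0 :: "3 \<Rightarrow> real^2" and E0 V1 V2 V3 :: "real^2"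
  assumes "E0 \<in> interior (convex hull (range P0))"
    and "voronoi_vertices P0 E0 V1 V2 V3"
  shows "cooperative_length P0 E0 \<le> ereal (decentralized_length E0 V1 V2 V3) \<and>
         ereal (decentralized_length E0 V1 V2 V3) \<le> 2 * cooperative_length P0 E0"
proof
  note cl = closure_voronoi_cell_eq_triangle[OF assms]
  have le: "norm (V2 - V3) \<le> norm (V1 - V3)" "norm (V1 - V3) \<le> norm (V1 - V2)"
    using assms(2) by (auto simp: voronoi_vertices_def)
  have int: "E0 \<in> interior (convex hull {V1, V2, V3})"
    unfolding cl[symmetric] using evader_in_voronoi_cell[OF assms(1)]
      interior_maximal[OF closure_subset open_voronoi_cell] by blast
  have nc: "\<not> collinear {V1, V2, V3}"
    by (rule interior_triangle_imp_not_collinear[OF int])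
  obtain l1 l2 l3 where l: "l1 > 0" "l2 > 0" "l3 > 0" "l1 + l2 + l3 = 1"
      "E0 = l1 *\<^sub>R V1 + l2 *\<^sub>R V2 + l3 *\<^sub>R V3"
    by (rule interior_triangle_barycentric[OF int])
  define D where "D = decentralized_length E0 V1 V2 V3"
  have D: "D = l1 * norm (V1 - V2) + l2 * norm (V1 - V2) + l3 * norm (V1 - V3)"
    unfolding D_def using l
    by (subst decentralized_length_barycentric[OF nc, of l1 l2 l3]) (auto simp: algebra_simps)

  have "guaranteed_time (initial_reflection P0 E0) P0 E0 \<le> ereal D"
    unfolding guaranteed_time_def
  proof (rule SUP_least, clarify)
    fix e P E assume pl: "(e, P, E) \<in> plays (initial_reflection P0 E0) P0 E0"
    then have e: "evader_control e"
      by (simp add: plays_def)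
    have perm: "{V2, V3, V1} = {V1, V2, V3}" "{V1, V3, V2} = {V1, V2, V3}"
      by auto
    \<comment> \<open>The pursuers \<open>i1\<close>, \<open>i2\<close>, \<open>i3\<close> are those
      whose bisectors carry the edges opposite to \<open>V1\<close>, \<open>V2\<close>,
      \<open>V3\<close>.\<close>
    obtain i1 where i1: "2 * ((P0 i1 - E0) \<bullet> (V2 - E0)) = (P0 i1 - E0) \<bullet> (P0 i1 - E0)"
        "2 * ((P0 i1 - E0) \<bullet> (V3 - E0)) = (P0 i1 - E0) \<bullet> (P0 i1 - E0)"
      using edge_on_bisector[of P0 E0 V2 V3 V1] cl nc unfolding perm by metis
    obtain i2 where i2: "2 * ((P0 i2 - E0) \<bullet> (V1 - E0)) = (P0 i2 - E0) \<bullet> (P0 i2 - E0)"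
        "2 * ((P0 i2 - E0) \<bullet> (V3 - E0)) = (P0 i2 - E0) \<bullet> (P0 i2 - E0)"
      using edge_on_bisector[of P0 E0 V1 V3 V2] cl nc unfolding perm by metis
    obtain i3 where i3: "2 * ((P0 i3 - E0) \<bullet> (V1 - E0)) = (P0 i3 - E0) \<bullet> (P0 i3 - E0)"
        "2 * ((P0 i3 - E0) \<bullet> (V2 - E0)) = (P0 i3 - E0) \<bullet> (P0 i3 - E0)"
      using edge_on_bisector[of P0 E0 V1 V2 V3] cl nc by metis
    define L where "L = norm (V1 - V2)"
    define M where "M = norm (V1 - V3)"
    have pos: "L > 0" "M > 0"
      using nc by (auto simp: L_def M_def insert_commute)
    have D': "D = l1 * L + l2 * L + l3 * M"
      by (simp add: D L_def M_def)
    then have D_pos: "D > 0"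
      using l pos by (simp add: add_pos_pos)
    define r where "r i s = reflect_rate (P0 i - E0) (e s)" for i s
    define R where "R i = integral {0..D} (r i)" for i
    \<comment> \<open>The dual constraint for the direction \<open>x\<close>: the coordinate losses
      in \<open>norm_barycentric_le\<close> are rewritten as reflection rates.\<close>
    have rate: "norm x \<le> l1 * L * reflect_rate (P0 i1 - E0) x +
        l2 * L * reflect_rate (P0 i2 - E0) x + l3 * M * reflect_rate (P0 i3 - E0) x" for x
    proof -
      obtain a b c where x: "a + b + c = 0" "x = a *\<^sub>R V1 + b *\<^sub>R V2 + c *\<^sub>R V3"
        by (rule plane_direction_barycentric[OF nc])
      have nz: "P0 i - E0 \<noteq> 0" for i
        using pursuer_ne_evader[OF assms(1)] by simp
      have "max 0 (- a) = l1 * reflect_rate (P0 i1 - E0) x"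
        by (rule bisector_barycentric_rate[OF nz l(1) _ _ _ _ i1, of l2 l3 V1 b c a])
          (use l x in \<open>auto simp: algebra_simps\<close>)
      moreover have "max 0 (- b) = l2 * reflect_rate (P0 i2 - E0) x"
        by (rule bisector_barycentric_rate[OF nz l(2) _ _ _ _ i2, of l1 l3 V2 a c b])
          (use l x in \<open>auto simp: algebra_simps\<close>)
      moreover have "max 0 (- c) = l3 * reflect_rate (P0 i3 - E0) x"
        by (rule bisector_barycentric_rate[OF nz l(3) l(4,5) x i3])
      ultimately show ?thesis
        using norm_barycentric_le[OF x(1) le] x(2) by (simp add: L_def M_def mult_ac)
    qed
    have int_r: "(r i has_integral R i) {0..D}" for i
      unfolding R_def r_def
      by (intro integrable_integral integrable_evader_control[OF e] continuous_reflect_rate)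
    have "((\<lambda>_. 1::real) has_integral D) {0..D}"
      using has_integral_const_real[of "1::real" 0 D] D_pos by simp
    moreover have "((\<lambda>s. l1 * L * r i1 s + l2 * L * r i2 s + l3 * M * r i3 s)
        has_integral (l1 * L * R i1 + l2 * L * R i2 + l3 * M * R i3)) {0..D}"
      by (intro has_integral_add has_integral_mult_right int_r)
    moreover have "1 \<le> l1 * L * r i1 s + l2 * L * r i2 s + l3 * M * r i3 s"
      if "s \<in> {0..D}" for s
      using rate[of "e s"] e that by (simp add: r_def evader_control_def)
    ultimately have D_le: "D \<le> l1 * L * R i1 + l2 * L * R i2 + l3 * M * R i3"
      by (rule has_integral_le)
    \<comment> \<open>The weights \<open>l1 * L\<close>, \<open>l2 * L\<close>,
      \<open>l3 * M\<close> are positive and add up to \<open>D\<close>, so a weighted sum of at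
      least \<open>D\<close> forces some accumulated rate to reach 1.\<close>
    have "\<exists>i. R i \<ge> 1"
    proof (rule ccontr)
      assume "\<not> (\<exists>i. R i \<ge> 1)"
      then have "R i < 1" for i by (simp add: not_le)
      then have "l1 * L * R i1 < l1 * L * 1" "l2 * L * R i2 < l2 * L * 1" "l3 * M * R i3 < l3 * M * 1"
        using l pos by (simp_all only: mult_strict_left_mono mult_pos_pos)
      with D_le D' show False by simp
    qed
    then show "capture_time P E \<le> ereal D"
      using capture_time_le[OF pl, of D] D_pos unfolding R_def r_def by force
  qed
  then show "cooperative_length P0 E0 \<le> ereal (decentralized_length E0 V1 V2 V3)"
    unfolding cooperative_length_def D_def
    by (intro INF_lower2) (auto simp: cooperative_strategy_initial_reflection)

  have "D \<le> (l1 + l2 + l3) * norm (V1 - V2)"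
    unfolding D using l(3) mult_left_mono[OF le(2), of l3] by (simp add: distrib_right)
  also have "\<dots> \<le> dist V1 E0 + dist V2 E0"
    using l dist_triangle2[of V1 V2 E0] by (simp add: dist_norm)
  finally have "ereal D \<le> ereal (dist V1 E0) + ereal (dist V2 E0)"
    by simp
  also have "\<dots> \<le> cooperative_length P0 E0 + cooperative_length P0 E0"
    by (intro add_mono cooperative_length_ge_dist_closure) (auto simp: cl intro: hull_inc)
  also have "\<dots> = 2 * cooperative_length P0 E0"
    by (cases "cooperative_length P0 E0") auto
  finally show "ereal (decentralized_length E0 V1 V2 V3) \<le> 2 * cooperative_length P0 E0"
    by (simp add: D_def)
qed

end
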